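(* Let $N$ be a finite set of $n$ agents and $A$ a finite set of object types with quotas $(q_a)_{a\in A}$ satisfying $\sum_{a\in A}q_a\ge n$. If a rule $\varphi:\mathscr{P}^{n}\to\Pi$ satisfies equal-rank envy-freeness, then it also satisfies equal treatment of equals.
   Context: **Model.** $N=\{1,\dots,n\}$ is a finite set of agents and $A=\{a_1,\dots,a_m\}$ a finite set of object types. Each $a\in A$ has a supply (quota, number of copies) $q_a$, a positive integer, and $\sum_{a\in A}q_a\ge n$. $N$, $A$ and $(q_a)_{a\in A}$ are fixed. $\mathscr{P}$ is the set of all strict preferences (strict linear orders) on $A$. A preference profile is $P=(P_1,\dots,P_n)\in\mathscr{P}^n$, where $a\,P_i\,b$ means that agent $i$ strictly prefers $a$ to $b$. The rank of $a$ at $P_i$ is $P_i(a)=l$ if $a$ is the $l$-th choice of $i$ under $P_i$ (so the favorite object has rank 1). Let $U(P_i,a)=\{b\in A: b\,P_i\,a\}$ and $\widehat U(P_i,a)=U(P_i,a)\cup\{a\}$. A random assignment is an $n\times m$ matrix $\pi=(\pi_{ia})$ with nonnegative entries such that $\sum_{a\in A}\pi_{ia}=1$ for each $i\in N$ and $\sum_{i\in N}\pi_{ia}\le q_a$ for each $a\in A$. $\Pi$ is the set of all random assignments. A rule is a mapping $\varphi:\mathscr{P}^n\to\Pi$; $\varphi_i(P)$ is row $i$ and $\varphi_{ia}(P)$ the $(i,a)$ entry of $\varphi(P)$. **Equal-rank envy-freeness.** $\varphi$ satisfies equal-rank envy-freeness if for each $P\in\mathscr{P}^n$, each $a\in A$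 and all $i,j\in N$ such that $P_i(a)=P_j(a)$, $$\min\Big(\sum_{a'\in U(P_i,a)}\varphi_{ia'}(P)+\varphi_{ja}(P),\,1\Big)\le\sum_{a'\in\widehat U(P_i,a)}\varphi_{ia'}(P).$$ **Equal treatment of equals.** $\varphi$ satisfies equal treatment of equals if for each $P\in\mathscr{P}^n$ and each pair $i,j\in N$ such that $P_i=P_j$, $\varphi_i(P)=\varphi_j(P)$. *)

theory Defs
  imports "HOL-Analysis.Finite_Cartesian_Product" "HOL-Library.FuncSet"
begin

text \<open>
  Agents and object types are the elements of finite types \<open>'i\<close> and \<open>'o\<close>. A pair
  \<open>(a, b)\<close> in a preference relation means that \<open>a\<close> is strictly preferred to \<open>b\<close>.
\<close>

definition preferences :: "'o rel set" where
  "preferences = {R. strict_linear_order_on UNIV R}"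

definition profiles :: "('i \<Rightarrow> 'o rel) set" where
  "profiles = {P. \<forall>i. P i \<in> preferences}"

definition upper :: "'o rel \<Rightarrow> 'o \<Rightarrow> 'o set" where
  "upper R a = {b. (b, a) \<in> R}"

definition weak_upper :: "'o rel \<Rightarrow> 'o \<Rightarrow> 'o set" where
  "weak_upper R a = upper R a \<union> {a}"

text \<open>The favourite object has rank 1.\<close>

definition pref_rank :: "'o rel \<Rightarrow> 'o \<Rightarrow> nat" where
  "pref_rank R a = card (upper R a) + 1"

text \<open>In a matrix \<open>X :: real ^ 'o ^ 'i\<close>, \<open>X $ i\<close> is the row of agent \<open>i\<close>.\<close>

definition random_assignments :: "('o::finite \<Rightarrow> nat) \<Rightarrow> (real ^ 'o ^ 'i::finite) set" where
  "random_assignments q = {X.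
     (\<forall>i a. 0 \<le> X $ i $ a) \<and>
     (\<forall>i. (\<Sum>a\<in>UNIV. X $ i $ a) = 1) \<and>
     (\<forall>a. (\<Sum>i\<in>UNIV. X $ i $ a) \<le> real (q a))}"

text \<open>Values of a rule outside \<open>profiles\<close> are irrelevant: they are left unconstrained
  here, and the axioms below quantify over \<open>profiles\<close> only.\<close>

definition rules ::
  "('o::finite \<Rightarrow> nat) \<Rightarrow> (('i::finite \<Rightarrow> 'o rel) \<Rightarrow> real ^ 'o ^ 'i) set" where
  "rules q = profiles \<rightarrow> random_assignments q"

definition equal_rank_envy_free ::
  "(('i::finite \<Rightarrow> 'o::finite rel) \<Rightarrow> real ^ 'o ^ 'i) \<Rightarrow> bool" where
  "equal_rank_envy_free \<phi> \<longleftrightarrow>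
     (\<forall>P\<in>profiles. \<forall>a i j. pref_rank (P i) a = pref_rank (P j) a \<longrightarrow>
        min ((\<Sum>b\<in>upper (P i) a. \<phi> P $ i $ b) + \<phi> P $ j $ a) 1
          \<le> (\<Sum>b\<in>weak_upper (P i) a. \<phi> P $ i $ b))"

definition equal_treatment_of_equals ::
  "(('i::finite \<Rightarrow> 'o::finite rel) \<Rightarrow> real ^ 'o ^ 'i) \<Rightarrow> bool" where
  "equal_treatment_of_equals \<phi> \<longleftrightarrow>
     (\<forall>P\<in>profiles. \<forall>i j. P i = P j \<longrightarrow> \<phi> P $ i = \<phi> P $ j)"

end

theory Submission
  imports Defs
begin

text \<open>Let \<open>i\<close> and \<open>j\<close> have the same preference and let \<open>a\<close> be an object such that they receive
  the same probabilities of all objects better than \<open>a\<close>. Then the left-hand side of the envy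
  inequality at \<open>a\<close> is a partial row sum of agent \<open>j\<close>, so the truncation at 1 is inactive and
  the inequality says that \<open>i\<close> receives \<open>a\<close> with at least the probability of \<open>j\<close>. Exchanging
  \<open>i\<close> and \<open>j\<close> gives equality at \<open>a\<close>, and the rows agree by induction down the preference.\<close>

text \<open>Pairs list the better object first, so well-founded induction along \<open>R\<close>
  runs from the favourite object down to worse ones.\<close>

lemma wf_preference:
  fixes R :: "'o::finite rel"
  assumes "R \<in> preferences"
  shows "wf R"
proof (rule finite_acyclic_wf)
  show "acyclic R"
    using assms unfolding preferences_def strict_linear_order_on_def
    by (simp add: acyclic_irrefl)
qed simp

lemma sum_weak_upper:
  fixes R :: "'o::finite rel" and f :: "'o \<Rightarrow> real"
  assumes "R \<in> preferences"
  shows "(\<Sum>b\<in>weak_upper R a. f b) = (\<Sum>b\<in>upper R a. f b) + f a"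
proof -
  have "a \<notin> upper R a"
    using assms unfolding preferences_def strict_linear_order_on_def irrefl_def upper_def
    by blast
  then show ?thesis
    by (simp add: weak_upper_def)
qed

lemma equal_rank_envy_free_same_preference_le:
  fixes \<phi> :: "('i::finite \<Rightarrow> 'o::finite rel) \<Rightarrow> real ^ 'o ^ 'i"
  assumes "\<phi> \<in> rules q" and "equal_rank_envy_free \<phi>" and "P \<in> profiles"
    and "P i = P j"
    and better: "\<And>b. (b, a) \<in> P i \<Longrightarrow> \<phi> P $ i $ b = \<phi> P $ j $ b"
  shows "\<phi> P $ j $ a \<le> \<phi> P $ i $ a"
proof -
  have pref: "P i \<in> preferences"
    using assms(3) by (simp add: profiles_def)
  have "\<phi> P \<in> random_assignments q"
    using assms(1,3) unfolding rules_def by blast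
  then have nonneg: "\<And>b. 0 \<le> \<phi> P $ j $ b" and total: "(\<Sum>b\<in>UNIV. \<phi> P $ j $ b) = 1"
    by (simp_all add: random_assignments_def)
  have "(\<Sum>b\<in>upper (P i) a. \<phi> P $ i $ b) = (\<Sum>b\<in>upper (P i) a. \<phi> P $ j $ b)"
    by (rule sum.cong) (simp_all add: upper_def better)
  then have "(\<Sum>b\<in>upper (P i) a. \<phi> P $ i $ b) + \<phi> P $ j $ a
      = (\<Sum>b\<in>weak_upper (P i) a. \<phi> P $ j $ b)"
    by (simp add: sum_weak_upper[OF pref])
  \<comment> \<open>The bound 1 is read as the full row sum of \<open>j\<close>, whose omitted
    entries are nonnegative.\<close>
  also have "\<dots> \<le> 1"
    unfolding total[symmetric] by (rule sum_mono2) (simp_all add: nonneg)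
  finally have "(\<Sum>b\<in>upper (P i) a. \<phi> P $ i $ b) + \<phi> P $ j $ a \<le> 1" .
  moreover have "min ((\<Sum>b\<in>upper (P i) a. \<phi> P $ i $ b) + \<phi> P $ j $ a) 1
      \<le> (\<Sum>b\<in>weak_upper (P i) a. \<phi> P $ i $ b)"
    using assms(2-4) unfolding equal_rank_envy_free_def by metis
  ultimately show ?thesis
    by (simp add: sum_weak_upper[OF pref])
qed

theorem proposition3:
  fixes q :: "'o::finite \<Rightarrow> nat"
    and \<phi> :: "('i::finite \<Rightarrow> 'o rel) \<Rightarrow> real ^ 'o ^ 'i"
  assumes "\<And>a. 0 < q a"
    and "CARD('i) \<le> (\<Sum>a\<in>UNIV. q a)"
    and "\<phi> \<in> rules q"
    and "equal_rank_envy_free \<phi>"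
  shows "equal_treatment_of_equals \<phi>"
  unfolding equal_treatment_of_equals_def
proof (intro ballI allI impI)
  fix P :: "'i \<Rightarrow> 'o rel" and i j :: 'i
  assume P: "P \<in> profiles" and same: "P i = P j"
  have "wf (P i)"
    using P by (simp add: profiles_def wf_preference)
  then have "\<phi> P $ i $ a = \<phi> P $ j $ a" for a
  proof (induction a rule: wf_induct_rule)
    case (less a)
    show ?case
    proof (rule antisym)
      \<comment> \<open>With the roles exchanged, the premise concerns objects above
        \<open>a\<close> in \<open>P j\<close>; \<open>same\<close> carries the induction hypothesis
        over from \<open>P i\<close>.\<close>
      show "\<phi> P $ i $ a \<le> \<phi> P $ j $ a"
        by (rule equal_rank_envy_free_same_preference_le[OF assms(3,4) P same[symmetric]])
          (simp add: less.IH same)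
      show "\<phi> P $ j $ a \<le> \<phi> P $ i $ a"
        by (rule equal_rank_envy_free_same_preference_le[OF assms(3,4) P same less.IH])
    qed
  qed
  then show "\<phi> P $ i = \<phi> P $ j"
    by (simp add: vec_eq_iff)
qed

end
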